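(* Let $p$ be a prime number. Then whenever $r\geq 2$ is an integer, there are infinitely many $r$-tuples $(d_1,\ldots,d_r)$ of positive integers having the property that Artin's Conjecture fails over $\mathbb{Q}_p$ for a system of diagonal forms of respective degrees $d_1,\ldots,d_r$; that is, for which there exist an integer $s>d_1^2+\cdots+d_r^2$ and diagonal forms $F_1,\ldots,F_r\in\mathbb{Q}_p[x_1,\ldots,x_s]$ of respective degrees $d_1,\ldots,d_r$ such that the system $F_1(\mathbf{x})=\cdots=F_r(\mathbf{x})=0$ has no solution $\mathbf{x}\in\mathbb{Q}_p^s\setminus\{\mathbf{0}\}$.
   Context: $\mathbb{Q}_p$ denotes the field of $p$-adic numbers. Artin's Conjecture asserts that any collection of forms (homogeneous polynomials) $F_1,\ldots,F_r\in\mathbb{Q}_p[x_1,\ldots,x_s]$ of respective degrees $d_1,\ldots,d_r$ must possess a common non-trivial zero in $\mathbb{Q}_p^s$ provided only that $s>d_1^2+\cdots+d_r^2$. A diagonal form of degree $d$ is a form $a_1x_1^d+\cdots+a_sx_s^d$ with coefficients $a_i\in\mathbb{Q}_p$. *)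

theory Defs
  imports Complex_Main "HOL-Computational_Algebra.Primes" "HOL-Algebra.QuotRing"
begin

section \<open>The field of p-adic numbers\<close>

text \<open>
  The p-adic numbers are constructed as the completion of the rationals with respect to
  the p-adic absolute value: Cauchy sequences of rationals modulo null sequences.
  As the construction depends on the value \<open>p\<close>, it is a ring in the sense of HOL-Algebra.
\<close>

definition padic_val :: "nat \<Rightarrow> rat \<Rightarrow> int" where
  "padic_val p x = int (multiplicity (int p) (fst (quotient_of x)))
                 - int (multiplicity (int p) (snd (quotient_of x)))"

definition padic_abs :: "nat \<Rightarrow> rat \<Rightarrow> real" where
  "padic_abs p x = (if x = 0 then 0 else real p powi (- padic_val p x))"

definition padic_Cauchy :: "nat \<Rightarrow> (nat \<Rightarrow> rat) \<Rightarrow> bool" where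
  "padic_Cauchy p X \<longleftrightarrow> (\<forall>e>0. \<exists>N. \<forall>m\<ge>N. \<forall>n\<ge>N. padic_abs p (X m - X n) < e)"

definition padic_null :: "nat \<Rightarrow> (nat \<Rightarrow> rat) set" where
  "padic_null p = {X. (\<lambda>n. padic_abs p (X n)) \<longlonglongrightarrow> 0}"

definition padic_Cauchy_ring :: "nat \<Rightarrow> (nat \<Rightarrow> rat) ring" where
  "padic_Cauchy_ring p =
     \<lparr>carrier = {X. padic_Cauchy p X},
      mult = (\<lambda>X Y n. X n * Y n), one = (\<lambda>_. 1),
      zero = (\<lambda>_. 0), add = (\<lambda>X Y n. X n + Y n)\<rparr>"

definition padic_field :: "nat \<Rightarrow> (nat \<Rightarrow> rat) set ring" where
  "padic_field p = padic_Cauchy_ring p Quot padic_null p"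


section \<open>Systems of diagonal forms\<close>

text \<open>The value at \<open>x\<close> of the diagonal form in \<open>s\<close> variables with coefficients \<open>a\<close>; 
  the variables and coefficients are indexed by \<open>{..<s}\<close>.\<close>

definition diagonal_form ::
    "('a, 'b) ring_scheme \<Rightarrow> nat \<Rightarrow> nat \<Rightarrow> (nat \<Rightarrow> 'a) \<Rightarrow> (nat \<Rightarrow> 'a) \<Rightarrow> 'a" where
  "diagonal_form R s d a x = (\<Oplus>\<^bsub>R\<^esub>i\<in>{..<s}. a i \<otimes>\<^bsub>R\<^esub> (x i [^]\<^bsub>R\<^esub> d))"

definition has_nontrivial_zero ::
    "('a, 'b) ring_scheme \<Rightarrow> nat \<Rightarrow> nat list \<Rightarrow> (nat \<Rightarrow> nat \<Rightarrow> 'a) \<Rightarrow> bool" where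
  "has_nontrivial_zero R s ds a \<longleftrightarrow>
     (\<exists>x. (\<forall>i<s. x i \<in> carrier R) \<and> (\<exists>i<s. x i \<noteq> \<zero>\<^bsub>R\<^esub>) \<and>
          (\<forall>j<length ds. diagonal_form R s (ds ! j) (a j) x = \<zero>\<^bsub>R\<^esub>))"

definition Artin_fails_diagonal :: "('a, 'b) ring_scheme \<Rightarrow> nat list \<Rightarrow> bool" where
  "Artin_fails_diagonal R ds \<longleftrightarrow>
     (\<exists>s a. s > (\<Sum>j<length ds. (ds ! j)\<^sup>2) \<and>
            (\<forall>j<length ds. \<forall>i<s. a j i \<in> carrier R) \<and>
            \<not> has_nontrivial_zero R s ds a)"


section \<open>The p-adic numbers form a field\<close>

lemma padic_abs_0 [simp]: "padic_abs p 0 = 0"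
  by (simp add: padic_abs_def)

context
  fixes p :: nat
  assumes p: "prime p"
begin

lemma padic_abs_frac:
  assumes "a \<noteq> 0" "b \<noteq> 0"
  shows "padic_abs p (of_int a / of_int b) =
    real p powi (int (multiplicity (int p) b) - int (multiplicity (int p) a))"
proof -
  obtain c d where cd: "quotient_of (of_int a / of_int b) = (c, d)"
    by fastforce
  have d: "d > 0" using quotient_of_denom_pos[OF cd] .
  have eq: "(of_int a / of_int b :: rat) = of_int c / of_int d"
    using quotient_of_div[OF cd] .
  have c: "c \<noteq> 0" using eq assms d by auto
  have "(of_int (a * d) :: rat) = of_int (c * b)"
    using eq assms d by (simp add: field_simps)
  hence "a * d = c * b" by (simp only: of_int_eq_iff)
  moreover have "prime_elem (int p)" using p by simp
  ultimately have "multiplicity (int p) a + multiplicity (int p) d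
      = multiplicity (int p) c + multiplicity (int p) b"
    using prime_elem_multiplicity_mult_distrib[of "int p" a d]
      prime_elem_multiplicity_mult_distrib[of "int p" c b] assms c d by simp
  hence "- padic_val p (of_int a / of_int b)
      = int (multiplicity (int p) b) - int (multiplicity (int p) a)"
    unfolding padic_val_def cd fst_conv snd_conv by linarith
  thus ?thesis
    using assms by (simp add: padic_abs_def)
qed

lemma padic_abs_nonneg: "padic_abs p x \<ge> 0"
  by (simp add: padic_abs_def)

lemma padic_abs_eq_0_iff: "padic_abs p x = 0 \<longleftrightarrow> x = 0"
  using prime_gt_0_nat[OF p] by (simp add: padic_abs_def)

lemma rat_frac_cases:
  fixes x :: rat
  obtains a b where "x = of_int a / of_int b" "b \<noteq> 0"
  using quotient_of_div[of x] quotient_of_denom_pos[of x]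
  by (metis less_numeral_extra(3) surj_pair)

lemma padic_abs_mult: "padic_abs p (x * y) = padic_abs p x * padic_abs p y"
proof (cases "x = 0 \<or> y = 0")
  case False
  obtain a b where x: "x = of_int a / of_int b" "b \<noteq> 0" by (rule rat_frac_cases)
  obtain c d where y: "y = of_int c / of_int d" "d \<noteq> 0" by (rule rat_frac_cases)
  have nz: "a \<noteq> 0" "c \<noteq> 0" using False x y by auto
  have xy: "x * y = of_int (a * c) / of_int (b * d)" using x y by simp
  have pe: "prime_elem (int p)" "real p \<noteq> 0" using p by (auto simp: prime_gt_0_nat)
  show ?thesis
    unfolding xy unfolding x(1) y(1) using x(2) y(2) nz pe
    by (simp add: padic_abs_frac prime_elem_multiplicity_mult_distrib algebra_simps
             del: of_int_mult flip: power_int_add)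
qed auto

lemma padic_abs_1 [simp]: "padic_abs p 1 = 1"
  using p by (simp add: padic_abs_def padic_val_def)

lemma padic_abs_minus [simp]: "padic_abs p (- x) = padic_abs p x"
proof -
  have "(padic_abs p (-1))\<^sup>2 = 1"
    using padic_abs_mult[of "-1" "-1"] by (simp add: power2_eq_square)
  hence "padic_abs p (-1) = 1"
    using padic_abs_nonneg[of "-1"] by (auto simp: power2_eq_1_iff)
  thus ?thesis using padic_abs_mult[of "-1" x] by simp
qed

lemma padic_abs_ultrametric: "padic_abs p (x + y) \<le> max (padic_abs p x) (padic_abs p y)"
proof (cases "x = 0 \<or> y = 0 \<or> x + y = 0")
  case True
  thus ?thesis using padic_abs_nonneg by (auto simp: le_max_iff_disj)
next
  case False
  obtain a b where x: "x = of_int a / of_int b" "b \<noteq> 0" by (rule rat_frac_cases)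
  obtain c d where y: "y = of_int c / of_int d" "d \<noteq> 0" by (rule rat_frac_cases)
  define u v w where "u = a * d" and "v = c * b" and "w = b * d"
  have x': "x = of_int u / of_int w" and y': "y = of_int v / of_int w" and w: "w \<noteq> 0"
    using x y by (auto simp: u_def v_def w_def)
  have xy: "x + y = of_int (u + v) / of_int w" by (simp add: x' y' add_divide_distrib)
  have nz: "u \<noteq> 0" "v \<noteq> 0" "u + v \<noteq> 0" using False unfolding xy unfolding x' y' by auto
  let ?m = "multiplicity (int p)"
  have nu: "\<not> is_unit (int p)" using p by (metis not_prime_unit prime_nat_int_transfer)
  have "int p ^ min (?m u) (?m v) dvd u + v"
    by (intro dvd_add multiplicity_dvd') auto
  hence "min (?m u) (?m v) \<le> ?m (u + v)"
    using nz nu by (intro multiplicity_geI) auto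
  moreover have "real p \<ge> 1" using prime_ge_1_nat[OF p] by simp
  ultimately show ?thesis
    unfolding xy unfolding x' y' padic_abs_frac[OF nz(3) w] padic_abs_frac[OF nz(1) w]
      padic_abs_frac[OF nz(2) w]
    by (auto simp: le_max_iff_disj min_le_iff_disj intro: power_int_increasing)
qed

lemma padic_abs_add_le: "padic_abs p (x + y) \<le> padic_abs p x + padic_abs p y"
  using padic_abs_ultrametric[of x y] padic_abs_nonneg[of x] padic_abs_nonneg[of y] by linarith

lemma padic_Cauchy_const: "padic_Cauchy p (\<lambda>_. c)"
  by (simp add: padic_Cauchy_def)

lemma padic_Cauchy_uminus: "padic_Cauchy p X \<Longrightarrow> padic_Cauchy p (\<lambda>n. - X n)"
  unfolding padic_Cauchy_def by (metis minus_diff_minus padic_abs_minus)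

lemma padic_Cauchy_add:
  assumes "padic_Cauchy p X" "padic_Cauchy p Y"
  shows "padic_Cauchy p (\<lambda>n. X n + Y n)"
  unfolding padic_Cauchy_def
proof (intro allI impI)
  fix e :: real assume "e > 0"
  obtain N M where N: "\<forall>m\<ge>N. \<forall>n\<ge>N. padic_abs p (X m - X n) < e"
    and M: "\<forall>m\<ge>M. \<forall>n\<ge>M. padic_abs p (Y m - Y n) < e"
    using assms \<open>e > 0\<close> unfolding padic_Cauchy_def by metis
  show "\<exists>N. \<forall>m\<ge>N. \<forall>n\<ge>N. padic_abs p (X m + Y m - (X n + Y n)) < e"
  proof (intro exI[of _ "max N M"] allI impI)
    fix m n assume mn: "m \<ge> max N M" "n \<ge> max N M"
    have "padic_abs p ((X m - X n) + (Y m - Y n)) < e"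
      by (rule le_less_trans[OF padic_abs_ultrametric]) (use mn N M in auto)
    thus "padic_abs p (X m + Y m - (X n + Y n)) < e" by (simp add: algebra_simps)
  qed
qed

lemma padic_Cauchy_bounded:
  assumes "padic_Cauchy p X"
  obtains B where "B > 0" "\<And>n. padic_abs p (X n) \<le> B"
proof -
  obtain N where N: "\<forall>m\<ge>N. \<forall>n\<ge>N. padic_abs p (X m - X n) < 1"
    using assms unfolding padic_Cauchy_def by (meson zero_less_one)
  define B where "B = 1 + (\<Sum>n\<le>N. padic_abs p (X n))"
  have B: "padic_abs p (X n) \<le> B" for n
  proof (cases "n \<le> N")
    case True
    hence "padic_abs p (X n) \<le> (\<Sum>n\<le>N. padic_abs p (X n))"
      by (intro member_le_sum) (auto simp: padic_abs_nonneg)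
    thus ?thesis by (simp add: B_def)
  next
    case False
    have "padic_abs p (X N) \<le> (\<Sum>n\<le>N. padic_abs p (X n))"
      by (intro member_le_sum) (auto simp: padic_abs_nonneg)
    moreover have "padic_abs p (X n) \<le> padic_abs p (X n - X N) + padic_abs p (X N)"
      using padic_abs_add_le[of "X n - X N" "X N"] by simp
    moreover have "padic_abs p (X n - X N) < 1" using N False by simp
    ultimately show ?thesis by (simp add: B_def)
  qed
  have "B > 0" unfolding B_def
    by (intro add_pos_nonneg sum_nonneg) (auto simp: padic_abs_nonneg)
  with B that show thesis by blast
qed

lemma padic_Cauchy_mult:
  assumes "padic_Cauchy p X" "padic_Cauchy p Y"
  shows "padic_Cauchy p (\<lambda>n. X n * Y n)"
  unfolding padic_Cauchy_def
proof (intro allI impI)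
  fix e :: real assume e: "e > 0"
  obtain B where B: "B > 0" "\<And>n. padic_abs p (X n) \<le> B"
    using padic_Cauchy_bounded[OF assms(1)] by blast
  obtain C where C: "C > 0" "\<And>n. padic_abs p (Y n) \<le> C"
    using padic_Cauchy_bounded[OF assms(2)] by blast
  have "e / C > 0" "e / B > 0" using e B C by auto
  then obtain N M where N: "\<forall>m\<ge>N. \<forall>n\<ge>N. padic_abs p (X m - X n) < e / C"
    and M: "\<forall>m\<ge>M. \<forall>n\<ge>M. padic_abs p (Y m - Y n) < e / B"
    using assms unfolding padic_Cauchy_def by metis
  show "\<exists>N. \<forall>m\<ge>N. \<forall>n\<ge>N. padic_abs p (X m * Y m - X n * Y n) < e"
  proof (intro exI[of _ "max N M"] allI impI)
    fix m n assume mn: "m \<ge> max N M" "n \<ge> max N M"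
    have "padic_abs p (X m * (Y m - Y n)) \<le> B * padic_abs p (Y m - Y n)"
      unfolding padic_abs_mult by (intro mult_right_mono B padic_abs_nonneg)
    also have "\<dots> < e" using M mn B by (simp add: field_simps)
    finally have 1: "padic_abs p (X m * (Y m - Y n)) < e" .
    have "padic_abs p ((X m - X n) * Y n) \<le> padic_abs p (X m - X n) * C"
      unfolding padic_abs_mult by (intro mult_left_mono C padic_abs_nonneg)
    also have "\<dots> < e" using N mn C by (simp add: field_simps)
    finally have 2: "padic_abs p ((X m - X n) * Y n) < e" .
    have "padic_abs p (X m * (Y m - Y n) + (X m - X n) * Y n) < e"
      by (rule le_less_trans[OF padic_abs_ultrametric]) (use 1 2 in auto)
    thus "padic_abs p (X m * Y m - X n * Y n) < e" by (simp add: algebra_simps)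
  qed
qed

lemma cring_padic_Cauchy_ring: "cring (padic_Cauchy_ring p)"
proof (rule cringI)
  show "abelian_group (padic_Cauchy_ring p)"
  proof (rule abelian_groupI)
    fix X assume "X \<in> carrier (padic_Cauchy_ring p)"
    thus "\<exists>Y\<in>carrier (padic_Cauchy_ring p).
        Y \<oplus>\<^bsub>padic_Cauchy_ring p\<^esub> X = \<zero>\<^bsub>padic_Cauchy_ring p\<^esub>"
      by (intro bexI[of _ "\<lambda>n. - X n"])
        (auto simp: padic_Cauchy_ring_def padic_Cauchy_uminus)
  qed (auto simp: padic_Cauchy_ring_def padic_Cauchy_const padic_Cauchy_add add_ac)
  show "comm_monoid (padic_Cauchy_ring p)"
    by (rule comm_monoidI)
      (auto simp: padic_Cauchy_ring_def padic_Cauchy_const padic_Cauchy_mult mult_ac)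
qed (auto simp: padic_Cauchy_ring_def algebra_simps)

lemma padic_null_imp_Cauchy:
  assumes "X \<in> padic_null p"
  shows "padic_Cauchy p X"
  unfolding padic_Cauchy_def
proof (intro allI impI)
  fix e :: real assume "e > 0"
  then obtain N where N: "\<forall>n\<ge>N. padic_abs p (X n) < e"
    using assms padic_abs_nonneg by (auto simp: padic_null_def LIMSEQ_iff)
  have "padic_abs p (X m - X n) < e" if "m \<ge> N" "n \<ge> N" for m n
    using le_less_trans[OF padic_abs_ultrametric[of "X m" "- X n"], of e] N that by simp
  thus "\<exists>N. \<forall>m\<ge>N. \<forall>n\<ge>N. padic_abs p (X m - X n) < e" by blast
qed

lemma padic_null_mult:
  assumes "X \<in> padic_null p" "padic_Cauchy p Y"
  shows "(\<lambda>n. X n * Y n) \<in> padic_null p"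
proof -
  obtain B where B: "B > 0" "\<And>n. padic_abs p (Y n) \<le> B"
    using padic_Cauchy_bounded[OF assms(2)] by blast
  have "(\<lambda>n. padic_abs p (X n) * B) \<longlonglongrightarrow> 0 * B"
    using assms(1) by (intro tendsto_intros) (simp add: padic_null_def)
  hence "(\<lambda>n. padic_abs p (X n) * B) \<longlonglongrightarrow> 0" by simp
  hence "(\<lambda>n. padic_abs p (X n * Y n)) \<longlonglongrightarrow> 0"
    by (rule tendsto_sandwich[where h = "\<lambda>n. padic_abs p (X n) * B", OF _ _ tendsto_const, rotated 2])
      (auto simp: padic_abs_mult padic_abs_nonneg intro!: always_eventually mult_left_mono B)
  thus ?thesis by (simp add: padic_null_def)
qed

lemma padic_null_add:
  assumes "X \<in> padic_null p" "Y \<in> padic_null p"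
  shows "(\<lambda>n. X n + Y n) \<in> padic_null p"
proof -
  have "(\<lambda>n. padic_abs p (X n) + padic_abs p (Y n)) \<longlonglongrightarrow> 0"
    using tendsto_add[of "\<lambda>n. padic_abs p (X n)" 0 sequentially "\<lambda>n. padic_abs p (Y n)" 0] assms
    by (simp add: padic_null_def)
  hence "(\<lambda>n. padic_abs p (X n + Y n)) \<longlonglongrightarrow> 0"
    by (rule tendsto_sandwich[where h = "\<lambda>n. padic_abs p (X n) + padic_abs p (Y n)", OF _ _ tendsto_const, rotated 2])
      (auto simp: padic_abs_add_le padic_abs_nonneg intro!: always_eventually)
  thus ?thesis by (simp add: padic_null_def)
qed

lemma ideal_padic_null: "ideal (padic_null p) (padic_Cauchy_ring p)"
proof -
  interpret cring "padic_Cauchy_ring p" by (rule cring_padic_Cauchy_ring)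
  have minus: "\<ominus>\<^bsub>padic_Cauchy_ring p\<^esub> X = (\<lambda>n. - X n)" if "padic_Cauchy p X" for X
    by (rule minus_equality)
      (use that in \<open>auto simp: padic_Cauchy_ring_def padic_Cauchy_uminus\<close>)
  show ?thesis
  proof (rule idealI)
    show "ring (padic_Cauchy_ring p)" by (rule ring_axioms)
    show "subgroup (padic_null p) (add_monoid (padic_Cauchy_ring p))"
    proof (rule add.subgroupI)
      show "padic_null p \<subseteq> carrier (padic_Cauchy_ring p)"
        by (auto simp: padic_Cauchy_ring_def padic_null_imp_Cauchy)
      have "(\<lambda>_. 0) \<in> padic_null p" by (simp add: padic_null_def)
      thus "padic_null p \<noteq> {}" by blast
      fix X assume X: "X \<in> padic_null p"
      thus "\<ominus>\<^bsub>padic_Cauchy_ring p\<^esub> X \<in> padic_null p"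
        by (simp add: minus padic_null_imp_Cauchy) (simp add: padic_null_def)
      fix Y assume "Y \<in> padic_null p"
      with X show "X \<oplus>\<^bsub>padic_Cauchy_ring p\<^esub> Y \<in> padic_null p"
        using padic_null_add by (simp add: padic_Cauchy_ring_def)
    qed
  next
    fix X Y assume "X \<in> padic_null p" "Y \<in> carrier (padic_Cauchy_ring p)"
    hence "(\<lambda>n. X n * Y n) \<in> padic_null p"
      using padic_null_mult by (simp add: padic_Cauchy_ring_def)
    thus "X \<otimes>\<^bsub>padic_Cauchy_ring p\<^esub> Y \<in> padic_null p"
      and "Y \<otimes>\<^bsub>padic_Cauchy_ring p\<^esub> X \<in> padic_null p"
      by (simp_all add: padic_Cauchy_ring_def mult.commute)
  qed
qed

lemma padic_Cauchy_away_from_0: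
  assumes "padic_Cauchy p X" "X \<notin> padic_null p"
  obtains c N where "c > 0" "\<And>n. n \<ge> N \<Longrightarrow> padic_abs p (X n) \<ge> c"
proof -
  obtain c where c: "c > 0" "\<And>N. \<exists>n\<ge>N. padic_abs p (X n) \<ge> c"
    using assms(2) padic_abs_nonneg by (auto simp: padic_null_def LIMSEQ_iff not_less)
  obtain N where N: "\<forall>m\<ge>N. \<forall>n\<ge>N. padic_abs p (X m - X n) < c"
    using assms(1) c(1) unfolding padic_Cauchy_def by metis
  obtain m where m: "m \<ge> N" "padic_abs p (X m) \<ge> c" using c(2) by blast
  have "padic_abs p (X n) \<ge> c" if "n \<ge> N" for n
    using padic_abs_ultrametric[of "X m - X n" "X n"] N m that by (fastforce simp: max_def split: if_splits)
  with c(1) that show thesis by blast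
qed

lemma padic_Cauchy_inverse:
  assumes "padic_Cauchy p X" "X \<notin> padic_null p"
  shows "padic_Cauchy p (\<lambda>n. inverse (X n))"
    and "(\<lambda>n. 1 - X n * inverse (X n)) \<in> padic_null p"
proof -
  obtain c N where c: "c > 0" "\<And>n. n \<ge> N \<Longrightarrow> padic_abs p (X n) \<ge> c"
    using padic_Cauchy_away_from_0[OF assms] by blast
  have nz: "X n \<noteq> 0" if "n \<ge> N" for n using c that by fastforce
  show "padic_Cauchy p (\<lambda>n. inverse (X n))"
    unfolding padic_Cauchy_def
  proof (intro allI impI)
    fix e :: real assume "e > 0"
    hence "e * c\<^sup>2 > 0" using c by simp
    then obtain M where M: "\<forall>m\<ge>M. \<forall>n\<ge>M. padic_abs p (X m - X n) < e * c\<^sup>2"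
      using assms(1) unfolding padic_Cauchy_def by metis
    show "\<exists>N. \<forall>m\<ge>N. \<forall>n\<ge>N. padic_abs p (inverse (X m) - inverse (X n)) < e"
    proof (intro exI[of _ "max N M"] allI impI)
      fix m n assume mn: "m \<ge> max N M" "n \<ge> max N M"
      let ?D = "padic_abs p (inverse (X m) - inverse (X n))"
      have "(inverse (X m) - inverse (X n)) * (X m * X n) = X n - X m"
        using nz mn by (simp add: field_simps)
      hence "?D * (padic_abs p (X m) * padic_abs p (X n)) = padic_abs p (X n - X m)"
        by (metis padic_abs_mult)
      moreover have "?D * c\<^sup>2 \<le> ?D * (padic_abs p (X m) * padic_abs p (X n))"
        unfolding power2_eq_square using c mn
        by (intro mult_left_mono mult_mono) (auto simp: padic_abs_nonneg)
      moreover have "padic_abs p (X n - X m) < e * c\<^sup>2" using M mn by simp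
      ultimately have "?D * c\<^sup>2 < e * c\<^sup>2" by linarith
      thus "?D < e" using c(1) by simp
    qed
  qed
  have "\<forall>\<^sub>F n in sequentially. padic_abs p (1 - X n * inverse (X n)) = 0"
    using nz by (auto simp: eventually_sequentially intro!: exI[of _ N])
  thus "(\<lambda>n. 1 - X n * inverse (X n)) \<in> padic_null p"
    unfolding padic_null_def by (auto intro: tendsto_eventually)
qed

lemma maximalideal_padic_null: "maximalideal (padic_null p) (padic_Cauchy_ring p)"
proof (rule maximalidealI[OF ideal_padic_null])
  have "(\<lambda>_. 1) \<notin> padic_null p" by (simp add: padic_null_def LIMSEQ_const_iff)
  moreover have "(\<lambda>_. 1) \<in> carrier (padic_Cauchy_ring p)"
    by (simp add: padic_Cauchy_ring_def padic_Cauchy_const)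
  ultimately show "carrier (padic_Cauchy_ring p) \<noteq> padic_null p" by blast
next
  fix J assume J: "ideal J (padic_Cauchy_ring p)" "padic_null p \<subseteq> J"
  interpret J: ideal J "padic_Cauchy_ring p" by fact
  show "J = padic_null p \<or> J = carrier (padic_Cauchy_ring p)"
  proof (cases "J = padic_null p")
    case False
    with J(2) obtain X where X: "X \<in> J" "X \<notin> padic_null p" by blast
    have CX: "padic_Cauchy p X"
      using J.Icarr[OF X(1)] by (simp add: padic_Cauchy_ring_def)
    note inv = padic_Cauchy_inverse[OF CX X(2)]
    have "(\<lambda>n. X n * inverse (X n)) \<in> J"
      using J.I_r_closed[OF X(1), of "\<lambda>n. inverse (X n)"] inv(1)
      by (simp add: padic_Cauchy_ring_def)
    moreover have "(\<lambda>n. 1 - X n * inverse (X n)) \<in> J" using inv(2) J(2) by blast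
    ultimately have "(\<lambda>n. X n * inverse (X n) + (1 - X n * inverse (X n))) \<in> J"
      using additive_subgroup.a_closed[OF J.additive_subgroup_axioms,
          of "\<lambda>n. X n * inverse (X n)" "\<lambda>n. 1 - X n * inverse (X n)"]
      unfolding padic_Cauchy_ring_def by simp
    hence "\<one>\<^bsub>padic_Cauchy_ring p\<^esub> \<in> J" by (simp add: padic_Cauchy_ring_def)
    thus ?thesis using J.one_imp_carrier by blast
  qed auto
qed

lemma field_padic_field: "field (padic_field p)"
  unfolding padic_field_def
  by (rule maximalideal.quotient_is_field[OF maximalideal_padic_null cring_padic_Cauchy_ring])

end

end

theory Submission
  imports Defs "HOL-Number_Theory.Residues" "HOL-Real_Asymp.Real_Asymp"
begin

text \<open>
  The counterexamples have degrees \<open>D, 2 D, \<dots>, r D\<close> with \<open>D = p ^ t * (p - 1)\<close> and \<open>t\<close> large,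
  and all \<open>r\<close> forms have the same coefficients. Two ideas are combined.

  First, since the coefficients agree, a common zero \<open>x\<close> of the forms satisfies
  \<open>\<Sum>i. c i * f (x i ^ D) = 0\<close> for every polynomial \<open>f\<close> of degree at most \<open>r\<close> without constant
  term. Take \<open>f u = 1 - (1 - u) ^ r\<close>. If \<open>x i\<close> is a \<open>p\<close>-adic unit, then \<open>u = x i ^ D\<close> is \<open>1\<close> modulo
  \<open>p ^ (t + 1)\<close> by Euler's theorem, so \<open>f u\<close> is \<open>1\<close> modulo \<open>p ^ M\<close> with \<open>M = r * (t + 1)\<close>. If
  \<open>x i\<close> is integral but not a unit, then \<open>f u\<close> is divisible by the huge power \<open>p ^ D\<close>. Hence
  \<open>f (x i ^ D)\<close> just tells units from non-units: if all \<open>c i = 1\<close>, the number of unit coordinates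
  of an integral zero is a multiple of \<open>p ^ M\<close>, so with only \<open>p ^ M - 1\<close> variables there is no
  unit coordinate at all, and by homogeneity the only zero is trivial.

  Secondly, for \<open>r = 2\<close> these \<open>p ^ M - 1\<close> variables are too few by a constant factor. One takes \<open>N\<close>
  blocks of \<open>p ^ M - 1\<close> variables, the block of level \<open>g\<close> having the coefficient \<open>p ^ (M * g)\<close>. The
  counting argument, applied modulo \<open>p ^ (M * (g + 1))\<close> to the lowest level \<open>g\<close> that contains a
  unit, still works as long as \<open>N * M \<le> D\<close>. This is \<open>padic_primitive_not_near_zero\<close>.

  The sum of the squares of the degrees is at most \<open>r ^ 3 * p ^ (2 * (t + 1))\<close>, so \<open>N = 2 * r ^ 3\<close>
  blocks give enough variables, and \<open>N * M \<le> D\<close> holds for all large \<open>t\<close> because \<open>M\<close> is linear and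
  \<open>D\<close> exponential in \<open>t\<close>.

  The argument is carried out for rational vectors, in a quantitative form: a rational vector of
  size at least \<open>e\<close> cannot make all the forms smaller than a fixed positive bound. A zero over the
  \<open>p\<close>-adic field is represented by Cauchy sequences of rationals, along which all the forms tend to
  \<open>0\<close> while some coordinate stays away from \<open>0\<close>, which contradicts that bound.
\<close>

section \<open>The p-adic absolute value on the rationals\<close>

context
  fixes p :: nat
  assumes p: "prime p"
begin

lemma padic_abs_power: "padic_abs p (x ^ n) = padic_abs p x ^ n"
  by (induction n) (simp_all add: p padic_abs_mult)

lemma padic_abs_inverse: "padic_abs p (inverse x) = inverse (padic_abs p x)"
proof (cases "x = 0")
  case False
  hence "padic_abs p x * padic_abs p (inverse x) = 1"
    by (simp add: p flip: padic_abs_mult)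
  thus ?thesis by (simp add: inverse_unique)
qed simp

lemma padic_abs_sum_le:
  assumes "finite A" "B \<ge> 0" "\<And>i. i \<in> A \<Longrightarrow> padic_abs p (f i) \<le> B"
  shows "padic_abs p (sum f A) \<le> B"
  using assms
proof (induction A rule: finite_induct)
  case (insert a A)
  have "padic_abs p (f a + sum f A) \<le> max (padic_abs p (f a)) (padic_abs p (sum f A))"
    by (rule padic_abs_ultrametric[OF p])
  also have "\<dots> \<le> B" using insert by simp
  finally show ?case using insert by simp
qed simp

lemma padic_abs_of_int:
  assumes "a \<noteq> 0"
  shows "padic_abs p (of_int a) = (1 / real p) ^ multiplicity (int p) a"
  using padic_abs_frac[OF p assms, of 1]
  by (simp add: power_int_minus power_one_over inverse_eq_divide)

lemma padic_abs_of_int_le_power_iff: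
  "padic_abs p (of_int a) \<le> (1 / real p) ^ k \<longleftrightarrow> int p ^ k dvd a"
proof (cases "a = 0")
  case False
  have p1: "real p > 1" using prime_gt_1_nat[OF p] by simp
  have nu: "\<not> is_unit (int p)" using prime_gt_1_nat[OF p] by simp
  have "padic_abs p (of_int a) \<le> (1 / real p) ^ k \<longleftrightarrow> k \<le> multiplicity (int p) a"
    using p1 by (simp add: padic_abs_of_int[OF False] power_one_over divide_simps)
  also have "\<dots> \<longleftrightarrow> int p ^ k dvd a"
    using False nu by (simp add: power_dvd_iff_le_multiplicity)
  finally show ?thesis .
qed simp

lemma padic_abs_of_int_le_1: "padic_abs p (of_int a) \<le> 1"
  using padic_abs_of_int_le_power_iff[of a 0] by simp

lemma padic_abs_of_prime: "padic_abs p (of_nat p) = 1 / real p"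
  using padic_abs_of_int[of "int p"] prime_gt_1_nat[OF p] by (simp add: multiplicity_self)

lemma padic_abs_value_group:
  assumes "x \<noteq> 0"
  obtains k where "padic_abs p x = real p powi k"
  using assms unfolding padic_abs_def by simp

text \<open>The value group is discrete: the nonzero values are the integral powers of \<open>p\<close>.\<close>

lemma padic_abs_less_1_imp_le:
  assumes "padic_abs p x < 1"
  shows "padic_abs p x \<le> 1 / real p"
proof (cases "x = 0")
  case False
  obtain k where k: "padic_abs p x = real p powi k"
    using padic_abs_value_group[OF False] .
  have p1: "real p > 1" using prime_gt_1_nat[OF p] by simp
  have "k < 0"
  proof (rule ccontr)
    assume "\<not> k < 0"
    hence "real p powi k \<ge> 1" using p1 by (simp add: one_le_power_int)
    thus False using k assms by simp
  qed
  hence "real p powi k \<le> real p powi (-1)"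
    using p1 by (intro power_int_increasing) auto
  thus ?thesis using k by (simp add: inverse_eq_divide)
qed simp

text \<open>
  The exponent is the totient of \<open>p ^ (t + 1)\<close>, so Euler's theorem applies to the numerator and
  to the denominator of \<open>x\<close>, both of which are prime to \<open>p\<close>.
\<close>

lemma padic_unit_power_near_1:
  assumes x: "padic_abs p x = 1"
  shows "padic_abs p (x ^ (p ^ t * (p - 1)) - 1) \<le> (1 / real p) ^ (t + 1)"
proof -
  let ?D = "p ^ t * (p - 1)" and ?q = "int p ^ (t + 1)"
  obtain a b where ab: "quotient_of x = (a, b)" by fastforce
  have cop: "coprime a b" using quotient_of_coprime[OF ab] .
  have b: "b > 0" using quotient_of_denom_pos[OF ab] .
  have xab: "x = of_int a / of_int b" using quotient_of_div[OF ab] .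
  have eq: "padic_abs p x * padic_abs p (of_int b) = padic_abs p (of_int a)"
    using b xab by (simp add: p flip: padic_abs_mult)
  have "1 / real p < 1" using prime_gt_1_nat[OF p] by simp
  hence dvd_iff: "padic_abs p (of_int c) < 1 \<longleftrightarrow> int p dvd c" for c
    using padic_abs_of_int_le_power_iff[of c 1] padic_abs_less_1_imp_le[of "of_int c"] by auto
  have ndvd: "\<not> int p dvd a" "\<not> int p dvd b"
    using eq x cop dvd_iff[of a] dvd_iff[of b] p
    by (auto dest: coprime_common_divisor[of a b "int p"])
  have tot: "totient (p ^ (t + 1)) = ?D"
    using totient_prime_power_Suc[OF p] by simp
  have euler: "[c ^ ?D = 1] (mod ?q)" if "\<not> int p dvd c" for c
  proof -
    have "coprime c (int p)"
      using that p by (metis coprime_commute prime_imp_coprime prime_nat_int_transfer)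
    hence "coprime c ?q" by (simp add: coprime_power_right_iff del: power_Suc)
    hence "coprime (c mod ?q) ?q"
      using prime_gt_0_nat[OF p] by (subst coprime_mod_left_iff) auto
    moreover have "int (nat (c mod ?q)) = c mod ?q"
      using prime_gt_0_nat[OF p] by simp
    ultimately have "coprime (nat (c mod ?q)) (p ^ (t + 1))"
      by (metis coprime_int_iff of_nat_power)
    hence "[nat (c mod ?q) ^ ?D = 1] (mod p ^ (t + 1))"
      using euler_theorem tot by metis
    hence "[int (nat (c mod ?q) ^ ?D) = int 1] (mod int (p ^ (t + 1)))"
      by (simp only: cong_int_iff)
    hence "[(c mod ?q) ^ ?D = 1] (mod ?q)"
      using prime_gt_0_nat[OF p] by simp
    moreover have "[c ^ ?D = (c mod ?q) ^ ?D] (mod ?q)"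
      by (intro cong_pow) (simp del: power_Suc add: cong_mod_right)
    ultimately show ?thesis using cong_trans by blast
  qed
  have "[a ^ ?D = b ^ ?D] (mod ?q)"
    using cong_trans[OF euler[OF ndvd(1)] cong_sym[OF euler[OF ndvd(2)]]] .
  hence "padic_abs p (of_int (a ^ ?D - b ^ ?D)) \<le> (1 / real p) ^ (t + 1)"
    using padic_abs_of_int_le_power_iff[of "a ^ ?D - b ^ ?D" "t + 1"]
    by (simp add: cong_iff_dvd_diff)
  moreover have "padic_abs p (of_int b) = 1"
    using dvd_iff[of b] ndvd(2) padic_abs_of_int_le_1[of b] by linarith
  moreover have "(x ^ ?D - 1) * of_int b ^ ?D = of_int (a ^ ?D - b ^ ?D)"
    using b by (simp add: xab power_divide field_simps)
  hence "padic_abs p (x ^ ?D - 1) * padic_abs p (of_int b) ^ ?D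
      = padic_abs p (of_int (a ^ ?D - b ^ ?D))"
    by (simp add: p flip: padic_abs_mult padic_abs_power)
  ultimately show ?thesis by simp
qed

section \<open>Primitive vectors are far from common zeros\<close>

text \<open>
  The left-hand side vanishes at \<open>u = 0\<close>, so it is a linear combination of \<open>u, \<dots>, u ^ r\<close> alone, with
  integral coefficients; this is what makes it a combination of the given forms.
\<close>

lemma one_minus_power_expand:
  fixes u :: "'a :: comm_ring_1"
  shows "1 - (1 - u) ^ r = (\<Sum>j=1..r. of_int ((-1) ^ (j + 1) * int (r choose j)) * u ^ j)"
proof -
  have "(1 - u) ^ r = (\<Sum>j\<le>r. of_nat (r choose j) * (- u) ^ j)"
    using binomial_ring[of "- u" 1 r] by simp
  also have "\<dots> = 1 + (\<Sum>j=1..r. of_nat (r choose j) * (- u) ^ j)"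
    by (simp add: atMost_atLeast0 sum.atLeast_Suc_atMost)
  finally show ?thesis
    by (simp add: power_minus[of u] mult_ac flip: sum_negf)
qed

text \<open>
  Suppose all the forms are at most \<open>(1 / p) ^ (N * M)\<close> at the primitive vector \<open>x\<close>, and let \<open>g\<close> be
  the lowest level of a unit coordinate. Modulo \<open>p ^ ((g + 1) * M)\<close> the combination
  \<open>\<Sum>i. c i * f (x i ^ D)\<close> is \<open>0\<close>, and only the unit coordinates of level \<open>g\<close> contribute to it, each
  of them \<open>p ^ (M * g)\<close>. Their number is therefore a positive multiple of \<open>p ^ M\<close>, more than the
  level holds.
\<close>

lemma padic_primitive_not_near_zero:
  fixes x :: "'i \<Rightarrow> rat" and level :: "'i \<Rightarrow> nat" and t :: nat
  defines "D \<equiv> p ^ t * (p - 1)"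
  assumes fin: "finite I" and M: "M = r * (t + 1)" and NM: "N * M \<le> D"
    and level: "\<And>i. i \<in> I \<Longrightarrow> level i < N"
    and fibre: "\<And>g. card {i \<in> I. level i = g} < p ^ M"
    and int: "\<And>i. i \<in> I \<Longrightarrow> padic_abs p (x i) \<le> 1"
    and prim: "\<exists>i\<in>I. padic_abs p (x i) = 1"
  shows "\<exists>j\<in>{1..r}. padic_abs p (\<Sum>i\<in>I. of_nat p ^ (M * level i) * x i ^ (j * D))
    > (1 / real p) ^ (N * M)"
proof (rule ccontr)
  let ?\<pi> = "1 / real p"
  let ?c = "\<lambda>i. of_nat p ^ (M * level i) :: rat"
  define b where "b j = (-1) ^ (j + 1) * int (r choose j)" for j
  define f where "f u = 1 - (1 - u) ^ r" for u :: rat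
  have f: "f u = (\<Sum>j=1..r. of_int (b j) * u ^ j)" for u
    unfolding f_def b_def by (rule one_minus_power_expand)
  define U where "U = {i \<in> I. padic_abs p (x i) = 1}"
  have \<pi>: "0 < ?\<pi>" "?\<pi> < 1" using prime_gt_1_nat[OF p] by auto
  have c: "padic_abs p (?c i) = ?\<pi> ^ (M * level i)" for i
    by (simp add: padic_abs_power padic_abs_of_prime)
  assume "\<not> ?thesis"
  hence small: "padic_abs p (\<Sum>i\<in>I. ?c i * x i ^ (j * D)) \<le> ?\<pi> ^ (N * M)"
    if "j \<in> {1..r}" for j using that by (auto simp: not_less)
  define g where "g = Min (level ` U)"
  have U: "finite U" "U \<noteq> {}" using fin prim by (auto simp: U_def)
  have g: "g \<in> level ` U" "\<And>i. i \<in> U \<Longrightarrow> g \<le> level i"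
    using U by (auto simp: g_def)
  have gN: "g < N" using g(1) level by (auto simp: U_def)
  have gM: "(g + 1) * M \<le> N * M" using gN by (intro mult_right_mono) auto
  let ?e = "?\<pi> ^ ((g + 1) * M)"
  define G where "G = {i \<in> U. level i = g}"
  have total: "padic_abs p (\<Sum>i\<in>I. ?c i * f (x i ^ D)) \<le> ?e"
  proof -
    have "(\<Sum>i\<in>I. ?c i * f (x i ^ D))
        = (\<Sum>i\<in>I. \<Sum>j=1..r. of_int (b j) * (?c i * x i ^ (j * D)))"
      by (simp add: f sum_distrib_left mult_ac flip: power_mult)
    also have "\<dots> = (\<Sum>j=1..r. of_int (b j) * (\<Sum>i\<in>I. ?c i * x i ^ (j * D)))"
      by (subst sum.swap) (simp add: sum_distrib_left)
    also have "padic_abs p \<dots> \<le> ?\<pi> ^ (N * M)"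
    proof (rule padic_abs_sum_le)
      fix j assume "j \<in> {1..r}"
      thus "padic_abs p (of_int (b j) * (\<Sum>i\<in>I. ?c i * x i ^ (j * D))) \<le> ?\<pi> ^ (N * M)"
        using mult_mono[OF padic_abs_of_int_le_1[of "b j"] small[of j]]
        by (simp add: padic_abs_mult[OF p] padic_abs_nonneg[OF p])
    qed (use \<pi> in auto)
    also have "\<dots> \<le> ?e" using \<pi> gM by (intro power_decreasing) auto
    finally show ?thesis .
  qed
  (* The three cases: units of level g give 1 up to p ^ M, units of higher level carry a
     coefficient divisible by p ^ ((g + 1) * M), and the D-th power of a non-unit is divisible by p ^ D. *)
  have term_le: "padic_abs p (?c i * f (x i ^ D) - (if i \<in> G then of_nat p ^ (M * g) else 0))
    \<le> ?e" if i: "i \<in> I" for i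
  proof (cases "i \<in> U")
    case True
    have near: "padic_abs p ((1 - x i ^ D) ^ r) \<le> ?\<pi> ^ M"
    proof -
      have "padic_abs p (1 - x i ^ D) \<le> ?\<pi> ^ (t + 1)"
        using padic_unit_power_near_1[of "x i" t] True padic_abs_minus[OF p, of "x i ^ D - 1"]
        by (simp add: U_def D_def)
      hence "padic_abs p (1 - x i ^ D) ^ r \<le> (?\<pi> ^ (t + 1)) ^ r"
        by (intro power_mono) (auto simp: padic_abs_nonneg p)
      also have "(?\<pi> ^ (t + 1)) ^ r = ?\<pi> ^ M" by (metis M mult.commute power_mult)
      finally show ?thesis by (simp only: padic_abs_power)
    qed
    show ?thesis
    proof (cases "level i = g")
      case lev: True
      hence "?c i * f (x i ^ D) - (if i \<in> G then of_nat p ^ (M * g) else 0)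
          = - (?c i * (1 - x i ^ D) ^ r)"
        using True by (simp add: G_def f_def algebra_simps)
      moreover have "padic_abs p (?c i * (1 - x i ^ D) ^ r) \<le> ?\<pi> ^ (M * g) * ?\<pi> ^ M"
        using near \<pi> lev unfolding padic_abs_mult[OF p] c
        by (intro mult_mono) (auto simp: padic_abs_nonneg p)
      ultimately show ?thesis by (simp add: p power_add mult_ac)
    next
      case False
      hence lev: "g + 1 \<le> level i" using g(2)[OF True] by simp
      have "f (x i ^ D) = 1 + - ((1 - x i ^ D) ^ r)" by (simp add: f_def)
      hence "padic_abs p (f (x i ^ D)) \<le> max 1 (padic_abs p ((1 - x i ^ D) ^ r))"
        using padic_abs_ultrametric[OF p, of 1 "- ((1 - x i ^ D) ^ r)"] by (simp add: p)
      also have "\<dots> \<le> 1" using near \<pi> power_le_one[of ?\<pi> M] by auto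
      finally have "padic_abs p (f (x i ^ D)) \<le> 1" .
      hence "padic_abs p (?c i * f (x i ^ D)) \<le> ?\<pi> ^ (M * level i) * 1"
        using \<pi> unfolding padic_abs_mult[OF p] c by (intro mult_left_mono) auto
      also have "\<dots> \<le> ?e"
      proof -
        have "(g + 1) * M \<le> M * level i" using lev by (metis mult.commute mult_le_mono2)
        thus ?thesis using \<pi> by (auto intro!: power_decreasing)
      qed
      finally show ?thesis using False by (simp add: G_def)
    qed
  next
    case False
    hence "padic_abs p (x i) \<le> ?\<pi>"
      using int[OF i] i padic_abs_less_1_imp_le[of "x i"] by (auto simp: U_def)
    hence "padic_abs p (x i ^ D) \<le> ?\<pi> ^ D"
      unfolding padic_abs_power by (intro power_mono) (auto simp: padic_abs_nonneg p)
    also have "\<dots> \<le> ?e" using \<pi> gM NM by (intro power_decreasing) auto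
    finally have u: "padic_abs p (x i ^ D) \<le> ?e" .
    have "padic_abs p (f (x i ^ D)) \<le> ?e"
      unfolding f
    proof (rule padic_abs_sum_le)
      fix j assume j: "j \<in> {1..r}"
      let ?u = "padic_abs p (x i ^ D)"
      have "?u \<le> 1" using u \<pi> power_le_one[of ?\<pi> "(g + 1) * M"] by linarith
      hence "?u ^ j \<le> ?u ^ 1" using j padic_abs_nonneg[OF p] by (intro power_decreasing) auto
      hence "?u ^ j \<le> ?e" using u by simp
      from mult_mono[OF padic_abs_of_int_le_1[of "b j"] this]
      show "padic_abs p (of_int (b j) * (x i ^ D) ^ j) \<le> ?e"
        by (simp add: padic_abs_mult[OF p] padic_abs_power padic_abs_nonneg[OF p])
    qed (use \<pi> in auto)
    hence "padic_abs p (?c i * f (x i ^ D)) \<le> 1 * ?e"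
      using \<pi> unfolding padic_abs_mult[OF p] c
      by (intro mult_mono) (auto simp: power_le_one padic_abs_nonneg p)
    thus ?thesis using False by (simp add: G_def)
  qed
  have "G \<subseteq> U" by (auto simp: G_def)
  hence G: "finite G" "G \<noteq> {}" "G \<subseteq> I"
    using U(1) finite_subset[of G U] g(1) by (auto simp: G_def U_def)
  have "(\<Sum>i\<in>I. if i \<in> G then of_nat p ^ (M * g) else 0) = of_nat (card G) * (of_nat p ^ (M * g) :: rat)"
    using G fin by (simp add: sum.If_cases Int_absorb1)
  hence "of_nat (card G) * of_nat p ^ (M * g)
      = (\<Sum>i\<in>I. ?c i * f (x i ^ D))
        + - (\<Sum>i\<in>I. ?c i * f (x i ^ D) - (if i \<in> G then of_nat p ^ (M * g) else 0))"
    by (simp add: sum_subtractf)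
  also have "padic_abs p \<dots> \<le> ?e"
  proof (rule order_trans[OF padic_abs_ultrametric[OF p]], intro max.boundedI total)
    show "padic_abs p (- (\<Sum>i\<in>I. ?c i * f (x i ^ D)
        - (if i \<in> G then of_nat p ^ (M * g) else 0))) \<le> ?e"
      unfolding padic_abs_minus[OF p]
      by (rule padic_abs_sum_le[OF fin _ term_le]) (use \<pi> in auto)
  qed
  finally have "padic_abs p (of_nat (card G)) * ?\<pi> ^ (M * g) \<le> ?\<pi> ^ M * ?\<pi> ^ (M * g)"
    by (simp add: padic_abs_mult[OF p] padic_abs_power padic_abs_of_prime power_add mult_ac)
  hence "padic_abs p (of_int (int (card G))) \<le> ?\<pi> ^ M"
    using \<pi> by simp
  hence "p ^ M dvd card G"
    unfolding padic_abs_of_int_le_power_iff by (metis of_nat_dvd_iff of_nat_power)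
  moreover have "card G \<le> card {i \<in> I. level i = g}"
    using fin by (intro card_mono) (auto simp: G_def U_def)
  hence "card G < p ^ M" using fibre[of g] by simp
  ultimately show False using G by (auto dest: dvd_imp_le)
qed

text \<open>
  Dividing by a coordinate of largest absolute value makes \<open>x\<close> primitive. The exponent \<open>r * D\<close> of \<open>e\<close>
  is the largest of the degrees, which makes the bound uniform in \<open>j\<close>.
\<close>

lemma padic_not_near_zero:
  fixes x :: "'i \<Rightarrow> rat" and level :: "'i \<Rightarrow> nat" and t :: nat
  defines "D \<equiv> p ^ t * (p - 1)"
  assumes fin: "finite I" and M: "M = r * (t + 1)" and NM: "N * M \<le> D"
    and level: "\<And>i. i \<in> I \<Longrightarrow> level i < N"
    and fibre: "\<And>g. card {i \<in> I. level i = g} < p ^ M"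
    and e: "0 < e" "e \<le> 1" and far: "\<exists>i\<in>I. padic_abs p (x i) \<ge> e"
  shows "\<exists>j\<in>{1..r}. padic_abs p (\<Sum>i\<in>I. of_nat p ^ (M * level i) * x i ^ (j * D))
    > (1 / real p) ^ (N * M) * e ^ (r * D)"
proof -
  have "Max ((\<lambda>i. padic_abs p (x i)) ` I) \<in> (\<lambda>i. padic_abs p (x i)) ` I"
    using fin far by (intro Max_in) auto
  then obtain k where k: "k \<in> I" "padic_abs p (x k) = Max ((\<lambda>i. padic_abs p (x i)) ` I)"
    by auto
  have max: "padic_abs p (x i) \<le> padic_abs p (x k)" if "i \<in> I" for i
    using k fin that by simp
  have ek: "e \<le> padic_abs p (x k)" using far max by force
  hence nz: "x k \<noteq> 0" using e by auto
  define y where "y i = x i * inverse (x k)" for i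
  have y: "padic_abs p (y i) = padic_abs p (x i) / padic_abs p (x k)" for i
    by (simp add: y_def padic_abs_mult[OF p] padic_abs_inverse divide_inverse)
  have xy: "x i = x k * y i" for i using nz by (simp add: y_def)
  have "\<exists>j\<in>{1..r}. padic_abs p (\<Sum>i\<in>I. of_nat p ^ (M * level i) * y i ^ (j * D))
      > (1 / real p) ^ (N * M)"
    unfolding D_def
  proof (rule padic_primitive_not_near_zero[OF fin M NM[unfolded D_def] level fibre])
    show "padic_abs p (y i) \<le> 1" if "i \<in> I" for i
      using max[OF that] ek e by (simp add: y)
    show "\<exists>i\<in>I. padic_abs p (y i) = 1"
      using k(1) ek e by (intro bexI[of _ k]) (auto simp: y)
  qed
  then obtain j where j: "j \<in> {1..r}" and
    far_y: "padic_abs p (\<Sum>i\<in>I. of_nat p ^ (M * level i) * y i ^ (j * D)) > (1 / real p) ^ (N * M)"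
    by blast
  have "(\<Sum>i\<in>I. of_nat p ^ (M * level i) * x i ^ (j * D))
      = x k ^ (j * D) * (\<Sum>i\<in>I. of_nat p ^ (M * level i) * y i ^ (j * D))"
    by (subst xy) (simp add: power_mult_distrib sum_distrib_left mult_ac)
  hence "padic_abs p (\<Sum>i\<in>I. of_nat p ^ (M * level i) * x i ^ (j * D))
      = padic_abs p (\<Sum>i\<in>I. of_nat p ^ (M * level i) * y i ^ (j * D)) * padic_abs p (x k) ^ (j * D)"
    by (simp add: padic_abs_mult[OF p] padic_abs_power)
  also have "\<dots> > (1 / real p) ^ (N * M) * e ^ (r * D)"
  proof -
    have "e ^ (r * D) \<le> e ^ (j * D)"
      using e j by (intro power_decreasing) auto
    also have "\<dots> \<le> padic_abs p (x k) ^ (j * D)"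
      using e ek by (intro power_mono) auto
    finally have "e ^ (r * D) \<le> padic_abs p (x k) ^ (j * D)" .
    thus ?thesis
      using far_y e by (intro mult_less_le_imp_less) auto
  qed
  finally show ?thesis using j by blast
qed

section \<open>Transfer to the p-adic field\<close>

lemma padic_Cauchy_ring_power:
  "X [^]\<^bsub>padic_Cauchy_ring p\<^esub> (d :: nat) = (\<lambda>n. X n ^ d)"
proof -
  interpret cring "padic_Cauchy_ring p" by (rule cring_padic_Cauchy_ring[OF p])
  show ?thesis
    by (induction d) (auto simp: padic_Cauchy_ring_def nat_pow_def mult.commute)
qed

lemma padic_Cauchy_ring_finsum:
  assumes "finite A" "\<And>i. i \<in> A \<Longrightarrow> f i \<in> carrier (padic_Cauchy_ring p)"
  shows "(\<Oplus>\<^bsub>padic_Cauchy_ring p\<^esub>i\<in>A. f i) = (\<lambda>n. \<Sum>i\<in>A. f i n)"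
proof -
  interpret cring "padic_Cauchy_ring p" by (rule cring_padic_Cauchy_ring[OF p])
  show ?thesis using assms
  proof (induction A rule: finite_induct)
    case empty
    show ?case
      by (simp only: finsum_empty sum.empty) (simp add: padic_Cauchy_ring_def)
  next
    case (insert a A)
    have "(\<Oplus>\<^bsub>padic_Cauchy_ring p\<^esub>i\<in>insert a A. f i)
        = f a \<oplus>\<^bsub>padic_Cauchy_ring p\<^esub> (\<Oplus>\<^bsub>padic_Cauchy_ring p\<^esub>i\<in>A. f i)"
      using insert by (intro finsum_insert) auto
    thus ?case using insert by (simp add: padic_Cauchy_ring_def)
  qed
qed

lemma zero_padic_field: "\<zero>\<^bsub>padic_field p\<^esub> = padic_null p"
  by (simp add: padic_field_def FactRing_def)

lemma carrier_padic_field: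
  "carrier (padic_field p) = {padic_null p +>\<^bsub>padic_Cauchy_ring p\<^esub> X | X. padic_Cauchy p X}"
  by (auto simp: padic_field_def FactRing_def A_RCOSETS_def' padic_Cauchy_ring_def)

text \<open>
  Passing to the quotient by the null sequences is a ring homomorphism, and the operations on Cauchy
  sequences are pointwise; so a zero of the form over the field is a null sequence of values at
  rational points.
\<close>

lemma diagonal_form_padic_field_eq_zeroD:
  assumes a: "\<And>i. i < s \<Longrightarrow> padic_Cauchy p (a i)" and X: "\<And>i. i < s \<Longrightarrow> padic_Cauchy p (X i)"
    and x: "\<And>i. i < s \<Longrightarrow> x i = padic_null p +>\<^bsub>padic_Cauchy_ring p\<^esub> X i"
    and zero: "diagonal_form (padic_field p) s d
      (\<lambda>i. padic_null p +>\<^bsub>padic_Cauchy_ring p\<^esub> a i) x = \<zero>\<^bsub>padic_field p\<^esub>"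
  shows "(\<lambda>n. padic_abs p (\<Sum>i<s. a i n * X i n ^ d)) \<longlonglongrightarrow> 0"
proof -
  let ?R = "padic_Cauchy_ring p" and ?I = "padic_null p"
  interpret I: ideal ?I ?R by (rule ideal_padic_null[OF p])
  interpret Q: field "padic_field p" by (rule field_padic_field[OF p])
  have hom: "ring_hom_ring ?R (padic_field p) ((+>\<^bsub>?R\<^esub>) ?I)"
    unfolding padic_field_def by (rule I.rcos_ring_hom_ring)
  interpret h: ring_hom_ring ?R "padic_field p" "(+>\<^bsub>?R\<^esub>) ?I" by (rule hom)
  have ca: "a i \<in> carrier ?R" "X i \<in> carrier ?R" if "i < s" for i
    using a X that by (auto simp: padic_Cauchy_ring_def)
  have sum_eq: "(\<Oplus>\<^bsub>?R\<^esub>i\<in>{..<s}. a i \<otimes>\<^bsub>?R\<^esub> X i [^]\<^bsub>?R\<^esub> d) = (\<lambda>n. \<Sum>i<s. a i n * X i n ^ d)"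
  proof -
    have "(\<Oplus>\<^bsub>?R\<^esub>i\<in>{..<s}. a i \<otimes>\<^bsub>?R\<^esub> X i [^]\<^bsub>?R\<^esub> d)
        = (\<lambda>n. \<Sum>i<s. (a i \<otimes>\<^bsub>?R\<^esub> X i [^]\<^bsub>?R\<^esub> d) n)"
      using ca by (intro padic_Cauchy_ring_finsum) auto
    also have "\<dots> = (\<lambda>n. \<Sum>i<s. a i n * X i n ^ d)"
      unfolding padic_Cauchy_ring_power by (simp add: padic_Cauchy_ring_def)
    finally show ?thesis .
  qed
  have "diagonal_form (padic_field p) s d (\<lambda>i. ?I +>\<^bsub>?R\<^esub> a i) x
      = (\<Oplus>\<^bsub>padic_field p\<^esub>i\<in>{..<s}. ?I +>\<^bsub>?R\<^esub> (a i \<otimes>\<^bsub>?R\<^esub> X i [^]\<^bsub>?R\<^esub> d))"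
    unfolding diagonal_form_def
    by (rule Q.finsum_cong') (use ca x in \<open>auto simp: h.hom_nat_pow\<close>)
  also have "\<dots> = ?I +>\<^bsub>?R\<^esub> (\<Oplus>\<^bsub>?R\<^esub>i\<in>{..<s}. a i \<otimes>\<^bsub>?R\<^esub> X i [^]\<^bsub>?R\<^esub> d)"
    using ca by (subst h.hom_finsum) (auto simp: comp_def Pi_def)
  also have "(\<Oplus>\<^bsub>?R\<^esub>i\<in>{..<s}. a i \<otimes>\<^bsub>?R\<^esub> X i [^]\<^bsub>?R\<^esub> d) = (\<lambda>n. \<Sum>i<s. a i n * X i n ^ d)"
    by (rule sum_eq)
  finally have eq: "?I +>\<^bsub>?R\<^esub> (\<lambda>n. \<Sum>i<s. a i n * X i n ^ d) = ?I"
    unfolding zero zero_padic_field by (rule sym)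
  have "(\<Oplus>\<^bsub>?R\<^esub>i\<in>{..<s}. a i \<otimes>\<^bsub>?R\<^esub> X i [^]\<^bsub>?R\<^esub> d) \<in> carrier ?R"
    using ca by (intro I.finsum_closed) auto
  hence "(\<lambda>n. \<Sum>i<s. a i n * X i n ^ d) \<in> ?I"
    unfolding sum_eq using eq by (rule I.rcos_const_imp_mem)
  thus ?thesis by (simp add: padic_null_def)
qed

text \<open>
  The variables are numbered block by block, each block having \<open>p ^ M - 1\<close> of them, so that
  \<open>i div (p ^ M - 1)\<close> is the level of the variable \<open>i\<close>.
\<close>

lemma Artin_fails_diagonal_multiples:
  fixes r t N :: nat
  defines "D \<equiv> p ^ t * (p - 1)" and "M \<equiv> r * (t + 1)"
  assumes NM: "N * M \<le> D"
    and many: "(\<Sum>j<r. (Suc j * D)\<^sup>2) < N * (p ^ M - 1)"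
  shows "Artin_fails_diagonal (padic_field p) (map (\<lambda>j. Suc j * D) [0..<r])"
proof -
  let ?R = "padic_Cauchy_ring p" and ?I = "padic_null p"
  interpret I: ideal ?I ?R by (rule ideal_padic_null[OF p])
  define s where "s = N * (p ^ M - 1)"
  define level where "level i = i div (p ^ M - 1)" for i
  define a :: "nat \<Rightarrow> nat \<Rightarrow> rat" where "a i = (\<lambda>_. of_nat p ^ (M * level i))" for i
  have pos: "p ^ M - 1 > 0" using many by (intro Nat.gr0I) simp
  have level: "level i < N" if "i < s" for i
    using that pos unfolding s_def level_def by (subst div_less_iff_less_mult)
  have fibre: "card {i \<in> {..<s}. level i = g} < p ^ M" for g
  proof -
    let ?m = "p ^ M - 1"
    have "{i \<in> {..<s}. level i = g} \<subseteq> {g * ?m..<g * ?m + ?m}"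
    proof
      fix i assume "i \<in> {i \<in> {..<s}. level i = g}"
      hence "g = i div ?m" by (simp add: level_def)
      thus "i \<in> {g * ?m..<g * ?m + ?m}"
        using div_times_less_eq_dividend[of i ?m] dividend_less_div_times[OF pos, of i]
        by (metis add.commute atLeastLessThan_iff)
    qed
    hence "card {i \<in> {..<s}. level i = g} \<le> card {g * ?m..<g * ?m + ?m}"
      by (intro card_mono) auto
    hence "card {i \<in> {..<s}. level i = g} \<le> ?m"
      by (simp only: card_atLeastLessThan add_diff_cancel_left')
    thus ?thesis using pos by linarith
  qed
  have no_zero: "\<not> has_nontrivial_zero (padic_field p) s (map (\<lambda>j. Suc j * D) [0..<r])
      (\<lambda>_ i. ?I +>\<^bsub>?R\<^esub> a i)"
  proof
    assume "has_nontrivial_zero (padic_field p) s (map (\<lambda>j. Suc j * D) [0..<r])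
      (\<lambda>_ i. ?I +>\<^bsub>?R\<^esub> a i)"
    then obtain x i0 where x: "\<forall>i<s. x i \<in> carrier (padic_field p)"
      and i0: "i0 < s" "x i0 \<noteq> \<zero>\<^bsub>padic_field p\<^esub>"
      and zero: "\<And>j. j < r \<Longrightarrow> diagonal_form (padic_field p) s (Suc j * D)
        (\<lambda>i. ?I +>\<^bsub>?R\<^esub> a i) x = \<zero>\<^bsub>padic_field p\<^esub>"
      by (auto simp: has_nontrivial_zero_def simp del: mult_Suc)
    have "\<forall>i<s. \<exists>Y. padic_Cauchy p Y \<and> x i = ?I +>\<^bsub>?R\<^esub> Y"
      using x by (auto simp: carrier_padic_field)
    then obtain X where X: "\<And>i. i < s \<Longrightarrow> padic_Cauchy p (X i)"
      "\<And>i. i < s \<Longrightarrow> x i = ?I +>\<^bsub>?R\<^esub> X i" by metis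
    have "X i0 \<notin> ?I"
      using i0 X(2) I.a_rcos_const[of "X i0"] by (auto simp: zero_padic_field)
    then obtain c n0 where c: "c > 0" "\<And>n. n \<ge> n0 \<Longrightarrow> padic_abs p (X i0 n) \<ge> c"
      using padic_Cauchy_away_from_0[OF p X(1)[OF i0(1)]] by blast
    define e where "e = min c 1"
    have e: "0 < e" "e \<le> 1" "\<And>n. n \<ge> n0 \<Longrightarrow> padic_abs p (X i0 n) \<ge> e"
      using c by (auto simp: e_def min_le_iff_disj)
    define \<delta> where "\<delta> = (1 / real p) ^ (N * M) * e ^ (r * D)"
    have \<delta>: "\<delta> > 0" using e prime_gt_0_nat[OF p] by (simp add: \<delta>_def)
    have "\<forall>\<^sub>F n in sequentially. padic_abs p (\<Sum>i<s. a i n * X i n ^ (Suc j * D)) < \<delta>"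
      if "j < r" for j
    proof (rule order_tendstoD(2)[OF _ \<delta>])
      show "(\<lambda>n. padic_abs p (\<Sum>i<s. a i n * X i n ^ (Suc j * D))) \<longlonglongrightarrow> 0"
        using diagonal_form_padic_field_eq_zeroD[OF _ X zero[OF that]]
        by (simp add: a_def padic_Cauchy_const p del: mult_Suc)
    qed
    hence "\<forall>\<^sub>F n in sequentially. \<forall>j\<in>{..<r}. padic_abs p (\<Sum>i<s. a i n * X i n ^ (Suc j * D)) < \<delta>"
      by (intro eventually_ball_finite) auto
    hence "\<forall>\<^sub>F n in sequentially. (\<forall>j\<in>{..<r}. padic_abs p (\<Sum>i<s. a i n * X i n ^ (Suc j * D)) < \<delta>)
        \<and> n \<ge> n0"
      by (intro eventually_conj eventually_ge_at_top)
    then obtain n where n: "n \<ge> n0"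
      and small: "\<And>j. j < r \<Longrightarrow> padic_abs p (\<Sum>i<s. a i n * X i n ^ (Suc j * D)) < \<delta>"
      by (auto simp: eventually_sequentially simp del: mult_Suc)
    have "\<exists>j\<in>{1..r}. padic_abs p (\<Sum>i<s. a i n * X i n ^ (j * D)) > \<delta>"
      unfolding a_def \<delta>_def D_def
      by (rule padic_not_near_zero[where x = "\<lambda>i. X i n" and level = level])
        (use NM[unfolded D_def] level fibre e n i0 in \<open>auto simp: M_def\<close>)
    then obtain j where j: "j \<in> {1..r}" "padic_abs p (\<Sum>i<s. a i n * X i n ^ (j * D)) > \<delta>" by blast
    hence "j - 1 < r" "Suc (j - 1) = j" by auto
    thus False using small[of "j - 1"] j(2) by simp
  qed
  have a_carrier: "?I +>\<^bsub>?R\<^esub> a i \<in> carrier (padic_field p)" for i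
    using padic_Cauchy_const[OF p] by (auto simp: carrier_padic_field a_def)
  have s_large: "(\<Sum>j<length (map (\<lambda>j. Suc j * D) [0..<r]). (map (\<lambda>j. Suc j * D) [0..<r] ! j)\<^sup>2) < s"
    using many by (simp add: s_def del: mult_Suc)
  show ?thesis
    unfolding Artin_fails_diagonal_def
    by (intro exI[of _ s] exI[of _ "\<lambda>_ i. ?I +>\<^bsub>?R\<^esub> a i"] conjI allI impI s_large a_carrier no_zero)
qed

end

section \<open>Counting variables\<close>

lemma eventually_linear_le_power_2:
  fixes c :: nat
  shows "\<exists>t0. \<forall>t\<ge>t0. c * (t + 1) \<le> 2 ^ t"
proof -
  have "(\<lambda>t. real c * ((real t + 1) / 2 ^ t)) \<longlonglongrightarrow> real c * 0"
    by (intro tendsto_intros) real_asymp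
  hence "\<forall>\<^sub>F t in sequentially. real c * ((real t + 1) / 2 ^ t) < 1"
    by (rule order_tendstoD) simp
  then obtain t0 where "\<And>t. t \<ge> t0 \<Longrightarrow> real c * ((real t + 1) / 2 ^ t) < 1"
    by (auto simp: eventually_sequentially)
  hence "real (c * (t + 1)) \<le> real (2 ^ t)" if "t \<ge> t0" for t
    using that[THEN \<open>\<And>t. t \<ge> t0 \<Longrightarrow> _\<close>] by (simp add: field_simps)
  thus ?thesis by (metis of_nat_le_iff)
qed

text \<open>
  Each degree is at most \<open>r * p ^ (t + 1)\<close>, so the squares add up to at most \<open>r ^ 3 * Q\<close> with
  \<open>Q = p ^ (r * (t + 1))\<close>; here \<open>r \<ge> 2\<close> enters. The factor \<open>2\<close> makes up for the \<open>- 1\<close>.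
\<close>

lemma sum_squares_multiples_less:
  fixes p r t :: nat
  assumes p: "p \<ge> 2" and r: "r \<ge> 2"
  shows "(\<Sum>j<r. (Suc j * (p ^ t * (p - 1)))\<^sup>2) < 2 * r ^ 3 * (p ^ (r * (t + 1)) - 1)"
proof -
  let ?Q = "p ^ (r * (t + 1))"
  have D: "p ^ t * (p - 1) \<le> p ^ (t + 1)" using p by simp
  have "(\<Sum>j<r. (Suc j * (p ^ t * (p - 1)))\<^sup>2) \<le> (\<Sum>j<r. (r * p ^ (t + 1))\<^sup>2)"
    using D by (intro sum_mono power_mono mult_mono) auto
  also have "\<dots> = r ^ 3 * p ^ (2 * (t + 1))"
    by (simp add: power_mult_distrib power2_eq_square power3_eq_cube mult_2 power_add)
  also have "\<dots> \<le> r ^ 3 * ?Q"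
    using p r by (intro mult_left_mono power_increasing mult_right_mono) auto
  also have "\<dots> < r ^ 3 * (2 * (?Q - 1))"
  proof -
    have "p ^ 2 \<le> ?Q" using p r by (intro power_increasing) auto
    moreover have "2 ^ 2 \<le> p ^ 2" using p by (intro power_mono) auto
    ultimately have "?Q \<ge> 4" by simp
    hence "?Q < 2 * (?Q - 1)" by linarith
    thus ?thesis using r by simp
  qed
  finally show ?thesis by (simp add: mult_ac)
qed

theorem theorem1p1:
  fixes p r :: nat
  assumes "prime p" and "r \<ge> 2"
  shows "infinite {ds :: nat list. length ds = r \<and> (\<forall>d\<in>set ds. d > 0) \<and>
                     Artin_fails_diagonal (padic_field p) ds}"
proof -
  have p: "p \<ge> 2" using prime_ge_2_nat[OF assms(1)] .
  define N where "N = 2 * r ^ 3"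
  define ds where "ds t = map (\<lambda>j. Suc j * (p ^ t * (p - 1))) [0..<r]" for t
  obtain t0 where t0: "\<And>t. t \<ge> t0 \<Longrightarrow> (N * r) * (t + 1) \<le> 2 ^ t"
    using eventually_linear_le_power_2 by blast
  have "Artin_fails_diagonal (padic_field p) (ds t)" if "t \<ge> t0" for t
    unfolding ds_def
  proof (rule Artin_fails_diagonal_multiples[OF assms(1), where N = N])
    have "N * (r * (t + 1)) \<le> 2 ^ t" using t0[OF that] by (simp add: mult_ac)
    also have "\<dots> \<le> p ^ t" using p by (intro power_mono) auto
    also have "\<dots> \<le> p ^ t * (p - 1)" using p by simp
    finally show "N * (r * (t + 1)) \<le> p ^ t * (p - 1)" .
  qed (use sum_squares_multiples_less[OF p assms(2)] in \<open>simp add: N_def del: mult_Suc\<close>)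
  moreover have "length (ds t) = r" "\<forall>d\<in>set (ds t). d > 0" for t
    using p by (auto simp: ds_def)
  ultimately have "ds ` {t0..} \<subseteq> {ds. length ds = r \<and> (\<forall>d\<in>set ds. d > 0) \<and>
      Artin_fails_diagonal (padic_field p) ds}"
    by blast
  (* The first degree already determines t. *)
  moreover have "inj_on ds {t0..}"
  proof (rule inj_onI)
    fix t u assume "ds t = ds u"
    hence "ds t ! 0 = ds u ! 0" by simp
    hence "p ^ t = p ^ u" using assms(2) p by (simp add: ds_def)
    thus "t = u" using p by simp
  qed
  hence "infinite (ds ` {t0..})" by (simp add: finite_image_iff infinite_Ici)
  ultimately show ?thesis using finite_subset by blast
qed

end
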